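(* Let $(S^x_n)$ be the singular reflected quadrant walk with data $(p,h,v,q)$ (as defined in the context), and let $f_n(i,j)=\mathbf P(Z_{(i,j)}=n)$, where $Z_{(i,j)}$ is its number of boundary contacts. Let $\alpha_1,\beta_{-1}\in(0,1)$, $\widetilde v_1$ and $\widetilde h_0$ be as defined in the context. Then for any $n\ge1$, as $i+j\to\infty$ (with $(i,j)\in\mathbb N_0^2$), $$f_n(i,j)=(1-\widetilde v_1)\,\widetilde v_1^{\,n-1}\alpha_1^i+(1-\widetilde h_0)\,\widetilde h_0^{\,n-1}\beta_{-1}^j+o(1).$$
   Context: $\mathbb N=\{1,2,\dots\}$, $\mathbb N_0=\{0,1,2,\dots\}$. **Singular reflected quadrant walk with data $(p,h,v,q)$.** Let $\{p_{k,\ell}\},\{h_{k,\ell}\},\{v_{k,\ell}\},\{q_{k,\ell}\}$, indexed by $(k,\ell)\in\mathbb Z^2$, be non-negative weights such that: (1) each family sums to $1$; (2) $p_{k,\ell}=0$ whenever $k\le -2$ or $\ell\le -2$; (3) $p_{-1,-1}=p_{-1,0}=p_{0,-1}=0$; (4) $p_{-1,1}\,p_{1,-1}\ne 0$; (5) $p_{k,\ell}>0$ for some $(k,\ell)$ with $k+\ell>0$; (6) $\sum_{k,\ell}p_{k,\ell}e^{kx+\ell y}$ is finite in a neighborhood of every point of the curve $\mathcal L=\{(x,y)\in\mathbb R^2:\sum_{k,\ell}p_{k,\ell}e^{kx+\ell y}=1\}$; (7) $h_{k,\ell}=v_{k,\ell}=q_{k,\ell}=0$ whenever $k<0$ or $\ell<0$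 or $(k,\ell)=(0,0)$; (8) $0<\sum\ell h_{k,\ell}<\infty$, $\sum k h_{k,\ell}<\infty$; $0<\sum k v_{k,\ell}<\infty$, $\sum\ell v_{k,\ell}<\infty$; $0<\sum k q_{k,\ell}<\infty$, $0<\sum\ell q_{k,\ell}<\infty$; (9) positive interior drift: $\sum k p_{k,\ell}>0$ and $\sum\ell p_{k,\ell}>0$. For $x\in\mathbb N_0^2$, $(S_n^x)_{n\ge0}$ is the Markov chain on $\mathbb N_0^2$ with $S_0^x=x$ whose increments are independent and distributed according to $p$ at points of $\mathbb N^2$, according to $h$ at points of $\mathbb N\times\{0\}$, according to $v$ at points of $\{0\}\times\mathbb N$, and according to $q$ at $(0,0)$. The number of boundary contacts is $Z_x=\sum_{n\ge0}\mathbf 1_{\{S_n^x\in\mathbb N_0^2\setminus\mathbb N^2\}}$. **Constants.** $\alpha_1$ and $\beta_{-1}$ are the unique solutions in $(0,1)$ of $\alpha=\sum_{k,\ell}p_{k,\ell}\alpha^{k+1}$ and $\beta=\sum_{k,\ell}p_{k,\ell}\beta^{\ell+1}$, respectively. $\widetilde v_1=\sum_{k,\ell}v_{k,\ell}\alpha_1^k$ and $\widetilde h_0=\sum_{k,\ell}h_{k,\ell}\beta_{-1}^\ell$. *)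

theory Defs
  imports "HOL-Probability.Probability" "HOL-Library.Landau_Symbols"
begin

definition weights :: "(int \<Rightarrow> int \<Rightarrow> real) \<Rightarrow> bool" where
  "weights w \<longleftrightarrow> (\<forall>k l. 0 \<le> w k l) \<and> ((\<lambda>(k, l). w k l) has_sum 1) UNIV"

definition mean1 :: "(int \<Rightarrow> int \<Rightarrow> real) \<Rightarrow> real" where
  "mean1 w = (\<Sum>\<^sub>\<infinity>(k, l)\<in>UNIV. of_int k * w k l)"

definition mean2 :: "(int \<Rightarrow> int \<Rightarrow> real) \<Rightarrow> real" where
  "mean2 w = (\<Sum>\<^sub>\<infinity>(k, l)\<in>UNIV. of_int l * w k l)"

definition finite_means :: "(int \<Rightarrow> int \<Rightarrow> real) \<Rightarrow> bool" where
  "finite_means w \<longleftrightarrow>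
     (\<lambda>(k, l). of_int k * w k l) summable_on UNIV \<and>
     (\<lambda>(k, l). of_int l * w k l) summable_on UNIV"

definition laplace_term :: "(int \<Rightarrow> int \<Rightarrow> real) \<Rightarrow> real \<times> real \<Rightarrow> int \<times> int \<Rightarrow> real" where
  "laplace_term w = (\<lambda>(x, y) (k, l). w k l * exp (of_int k * x + of_int l * y))"

definition level_curve :: "(int \<Rightarrow> int \<Rightarrow> real) \<Rightarrow> (real \<times> real) set" where
  "level_curve w = {z. (laplace_term w z has_sum 1) UNIV}"

(* An infinite sum that does not converge has value 0, so the strict inequalities
   for the drift of p include its convergence. *)
locale singular_reflected_data =
  fixes p h v q :: "int \<Rightarrow> int \<Rightarrow> real"
  assumes weights: "weights p" "weights h" "weights v" "weights q"
    and p_small_neg_jumps: "\<And>k l. k \<le> -2 \<or> l \<le> -2 \<Longrightarrow> p k l = 0"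
    and p_singular: "p (-1) (-1) = 0" "p (-1) 0 = 0" "p 0 (-1) = 0"
    and p_antidiagonal: "p (-1) 1 * p 1 (-1) \<noteq> 0"
    and p_outward: "\<exists>k l. k + l > 0 \<and> p k l > 0"
    and p_laplace_finite: "\<And>z. z \<in> level_curve p \<Longrightarrow>
           \<forall>\<^sub>F z' in nhds z. laplace_term p z' summable_on UNIV"
    and boundary_jumps: "\<And>k l. k < 0 \<or> l < 0 \<or> (k, l) = (0, 0) \<Longrightarrow>
           h k l = 0 \<and> v k l = 0 \<and> q k l = 0"
    and boundary_finite_means: "finite_means h" "finite_means v" "finite_means q"
    and boundary_drift: "mean2 h > 0" "mean1 v > 0" "mean1 q > 0" "mean2 q > 0"
    and interior_drift: "mean1 p > 0" "mean2 p > 0"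

definition jump_weights ::
  "(int \<Rightarrow> int \<Rightarrow> real) \<Rightarrow> (int \<Rightarrow> int \<Rightarrow> real) \<Rightarrow> (int \<Rightarrow> int \<Rightarrow> real) \<Rightarrow> (int \<Rightarrow> int \<Rightarrow> real)
     \<Rightarrow> nat \<times> nat \<Rightarrow> (int \<Rightarrow> int \<Rightarrow> real)" where
  "jump_weights p h v q = (\<lambda>(i, j).
     if i > 0 \<and> j > 0 then p
     else if i > 0 then h
     else if j > 0 then v
     else q)"

definition transition ::
  "(int \<Rightarrow> int \<Rightarrow> real) \<Rightarrow> (int \<Rightarrow> int \<Rightarrow> real) \<Rightarrow> (int \<Rightarrow> int \<Rightarrow> real) \<Rightarrow> (int \<Rightarrow> int \<Rightarrow> real)
     \<Rightarrow> nat \<times> nat \<Rightarrow> nat \<times> nat \<Rightarrow> real" where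
  "transition p h v q = (\<lambda>(i, j) (i', j').
     jump_weights p h v q (i, j) (int i' - int i) (int j' - int j))"

(* S is any realisation, on any probability space, of the Markov chain started at x. *)
locale reflected_walk = prob_space M for M :: "'a measure" +
  fixes p h v q :: "int \<Rightarrow> int \<Rightarrow> real"
    and x :: "nat \<times> nat"
    and S :: "nat \<Rightarrow> 'a \<Rightarrow> nat \<times> nat"
  assumes S_measurable: "\<And>n. S n \<in> measurable M (count_space UNIV)"
    and S_start: "AE \<omega> in M. S 0 \<omega> = x"
    and S_markov: "\<And>n w y. \<P>(\<omega> in M. \<forall>m\<le>n. S m \<omega> = w m) > 0 \<Longrightarrow>
           \<P>(\<omega> in M. S (Suc n) \<omega> = y \<bar> \<forall>m\<le>n. S m \<omega> = w m) = transition p h v q (w n) y"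

definition boundary :: "(nat \<times> nat) set" where
  "boundary = {(i, j). i = 0 \<or> j = 0}"

definition contacts :: "(nat \<Rightarrow> 'a \<Rightarrow> nat \<times> nat) \<Rightarrow> 'a \<Rightarrow> ennreal" where
  "contacts S \<omega> = (\<Sum>n. indicator boundary (S n \<omega>))"

(* The exponents k + 1 and l + 1 are nonnegative wherever p does not vanish. *)
definition alpha1 :: "(int \<Rightarrow> int \<Rightarrow> real) \<Rightarrow> real" where
  "alpha1 p = (THE a. 0 < a \<and> a < 1 \<and> a = (\<Sum>\<^sub>\<infinity>(k, l)\<in>UNIV. p k l * a powi (k + 1)))"

definition beta_m1 :: "(int \<Rightarrow> int \<Rightarrow> real) \<Rightarrow> real" where
  "beta_m1 p = (THE b. 0 < b \<and> b < 1 \<and> b = (\<Sum>\<^sub>\<infinity>(k, l)\<in>UNIV. p k l * b powi (l + 1)))"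

definition v_tilde1 :: "(int \<Rightarrow> int \<Rightarrow> real) \<Rightarrow> (int \<Rightarrow> int \<Rightarrow> real) \<Rightarrow> real" where
  "v_tilde1 p v = (\<Sum>\<^sub>\<infinity>(k, l)\<in>UNIV. v k l * alpha1 p powi k)"

definition h_tilde0 :: "(int \<Rightarrow> int \<Rightarrow> real) \<Rightarrow> (int \<Rightarrow> int \<Rightarrow> real) \<Rightarrow> real" where
  "h_tilde0 p h = (\<Sum>\<^sub>\<infinity>(k, l)\<in>UNIV. h k l * beta_m1 p powi l)"

end

theory Submission imports Defs begin

text \<open>
  Let T(m, x) be the probability of at least m contacts from x, so that f_n = T(n) - T(n + 1), and let
  a = alpha1, b = beta_m1. Far from the vertical axis only the vertical coordinate matters: it reaches 0
  from j with probability b^j and returns to 0 after each jump from the horizontal axis with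
  probability t = h_tilde0. This gives \<open>\<bar>T(m, (i, j)) - t^(m - 1) b^j\<bar> \<le> a^i\<close> for all i, j: for the
  upper bound, t^(m - 1) b^j + a^i is a supersolution of the recursion for the contacts up to a finite
  time; for the lower bound, a maximum principle in j is applied to the supremum over i of the defect.
  Exchanging the coordinates gives the analogous estimate with error b^j, and one of the two errors
  is small when i + j is large.
\<close>

subsection \<open>Weights, expectations and fixed points\<close>

text \<open>The data are given by unordered infinite sums, the argument uses expectations. Unordered
  summability of reals is absolute, which is integrability against the pmf.\<close>

lemma integrable_measure_pmf_iff_summable:
  fixes f :: "'a \<Rightarrow> real"
  shows "integrable (measure_pmf P) f \<longleftrightarrow> (\<lambda>x. pmf P x * f x) summable_on UNIV"
proof -
  have "integrable (measure_pmf P) f \<longleftrightarrow> integrable (count_space UNIV) (\<lambda>x. pmf P x * f x)"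
    unfolding measure_pmf_eq_density by (subst integrable_density) auto
  also have "\<dots> \<longleftrightarrow> Infinite_Sum.abs_summable_on (\<lambda>x. pmf P x * f x) UNIV"
    by (subst abs_summable_equivalent) (simp add: abs_summable_on_def)
  also have "\<dots> \<longleftrightarrow> (\<lambda>x. pmf P x * f x) summable_on UNIV"
    by (rule summable_on_iff_abs_summable_on_real[symmetric])
  finally show ?thesis .
qed

lemma expectation_pmf_eq_infsum:
  fixes f :: "'a \<Rightarrow> real"
  assumes "integrable (measure_pmf P) f"
  shows "measure_pmf.expectation P f = (\<Sum>\<^sub>\<infinity>x. pmf P x * f x)"
proof -
  have "Infinite_Sum.abs_summable_on (\<lambda>x. pmf P x * f x) UNIV"
    using assms unfolding integrable_measure_pmf_iff_summable
    by (rule iffD1[OF summable_on_iff_abs_summable_on_real])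
  thus ?thesis
    unfolding pmf_expectation_eq_infsetsum
    by (rule infsetsum_infsum[OF iffD1[OF abs_summable_equivalent]])
qed

lemma weights_pmf:
  assumes "weights w"
  obtains P where "\<And>k l. pmf P (k, l) = w k l"
proof -
  let ?f = "\<lambda>(k, l). w k l"
  have nn: "0 \<le> ?f x" for x
    using assms by (auto simp: weights_def split: prod.splits)
  have hs: "(?f has_sum 1) UNIV"
    using assms by (simp add: weights_def)
  have "Infinite_Sum.abs_summable_on ?f UNIV"
    by (rule iffD1[OF summable_on_iff_abs_summable_on_real has_sum_imp_summable[OF hs]])
  hence as: "Infinite_Set_Sum.abs_summable_on ?f UNIV"
    by (rule iffD1[OF abs_summable_equivalent])
  have "(\<integral>\<^sup>+x. ennreal (?f x) \<partial>count_space UNIV) = ennreal (infsetsum ?f UNIV)"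
    using as nn by (intro nn_integral_conv_infsetsum) auto
  also have "infsetsum ?f UNIV = 1"
    using as hs by (simp add: infsetsum_infsum infsumI)
  finally have "(\<integral>\<^sup>+x. ennreal (?f x) \<partial>count_space UNIV) = 1" by simp
  from pmf_embed_pmf[OF nn this] have "pmf (embed_pmf ?f) (k, l) = w k l" for k l
    by simp
  thus thesis using that by blast
qed

lemma measure_pmf_integrable_bounded:
  fixes f :: "'a \<Rightarrow> real"
  assumes "\<And>x. x \<in> set_pmf P \<Longrightarrow> \<bar>f x\<bar> \<le> C"
  shows "integrable (measure_pmf P) f"
  by (rule measure_pmf.integrable_const_bound[where B = C]) (auto simp: AE_measure_pmf_iff assms)

lemma expectation_pmf_mono:
  fixes f g :: "'a \<Rightarrow> real"
  assumes "integrable (measure_pmf P) f" "integrable (measure_pmf P) g"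
    and "\<And>x. x \<in> set_pmf P \<Longrightarrow> f x \<le> g x"
  shows "measure_pmf.expectation P f \<le> measure_pmf.expectation P g"
  using assms by (intro integral_mono_AE) (auto simp: AE_measure_pmf_iff)

lemma expectation_pmf_cong:
  fixes f g :: "'a \<Rightarrow> real"
  assumes "\<And>x. x \<in> set_pmf P \<Longrightarrow> f x = g x"
  shows "measure_pmf.expectation P f = measure_pmf.expectation P g"
  using assms by (intro integral_cong_AE) (auto simp: AE_measure_pmf_iff)

lemma expectation_pmf_eq_0_imp:
  fixes f :: "'a \<Rightarrow> real"
  assumes "integrable (measure_pmf P) f" "\<And>x. x \<in> set_pmf P \<Longrightarrow> 0 \<le> f x"
    and "measure_pmf.expectation P f \<le> 0" "x \<in> set_pmf P"
  shows "f x = 0"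
proof -
  have nn: "AE x in P. 0 \<le> f x" using assms(2) by (simp add: AE_measure_pmf_iff)
  with assms(3) have "measure_pmf.expectation P f = 0"
    by (intro antisym integral_nonneg_AE) auto
  with integral_nonneg_eq_0_iff_AE[OF assms(1) nn] assms(4) show ?thesis
    by (simp add: AE_measure_pmf_iff)
qed

text \<open>This is the extinction probability of a branching process with offspring mean above 1.
  Since \<open>1 - a ^ n = (1 - a) * (\<Sum>r<n. a ^ r)\<close>, a fixed point below 1 is a solution
  of \<open>\<psi> a = 1\<close>, and \<open>\<psi>\<close> increases strictly and continuously from
  at most 1 to the mean.\<close>

lemma subcritical_fixed_point:
  fixes K :: "nat pmf"
  assumes int: "integrable (measure_pmf K) real"
    and mean: "measure_pmf.expectation K real > 1"
    and zero: "0 \<in> set_pmf K"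
  shows "\<exists>!a::real. 0 < a \<and> a < 1 \<and> a = measure_pmf.expectation K (\<lambda>n. a ^ n)"
proof -
  define \<psi> :: "real \<Rightarrow> real"
    where "\<psi> a = measure_pmf.expectation K (\<lambda>n. \<Sum>r<n. a ^ r)" for a
  have geo_bound: "\<bar>\<Sum>r<n. a ^ r\<bar> \<le> real n" if "0 \<le> a" "a \<le> 1" for a :: real and n
  proof -
    have "(\<Sum>r<n. a ^ r) \<le> (\<Sum>r<n. 1)"
      using that by (intro sum_mono) (simp add: power_le_one)
    thus ?thesis using that by (simp add: sum_nonneg)
  qed
  have int_geo: "integrable (measure_pmf K) (\<lambda>n. \<Sum>r<n. a ^ r)" if "0 \<le> a" "a \<le> 1" for a :: real
    by (rule Bochner_Integration.integrable_bound[OF int]) (use that geo_bound in auto)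
  have key: "measure_pmf.expectation K (\<lambda>n. a ^ n) = 1 - (1 - a) * \<psi> a"
    if "0 \<le> a" "a \<le> 1" for a :: real
  proof -
    have "measure_pmf.expectation K (\<lambda>n. a ^ n)
        = measure_pmf.expectation K (\<lambda>n. 1 - (1 - a) * (\<Sum>r<n. a ^ r))"
      by (intro expectation_pmf_cong) (simp add: one_diff_power_eq[symmetric])
    also have "\<dots> = 1 - (1 - a) * \<psi> a"
      unfolding \<psi>_def using int_geo[OF that] by (subst Bochner_Integration.integral_diff) auto
    finally show ?thesis .
  qed
  \<comment> \<open>The geometric sum depends on \<open>a\<close> only for \<open>n \<ge> 2\<close>;
    a mean above 1 supplies such an \<open>n\<close>, which makes \<open>\<psi>\<close> strictly
    increasing.\<close>
  have two: "\<exists>n\<in>set_pmf K. n \<ge> 2"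
  proof (rule ccontr)
    assume "\<not> ?thesis"
    hence "measure_pmf.expectation K real \<le> measure_pmf.expectation K (\<lambda>_. 1)"
      using int by (intro expectation_pmf_mono) force+
    thus False using mean by simp
  qed
  have strict: "\<psi> a < \<psi> b" if "0 \<le> a" "a < b" "b \<le> 1" for a b
  proof (rule ccontr)
    assume "\<not> \<psi> a < \<psi> b"
    hence le: "measure_pmf.expectation K (\<lambda>n. (\<Sum>r<n. b ^ r) - (\<Sum>r<n. a ^ r)) \<le> 0"
      unfolding \<psi>_def using int_geo that by (subst Bochner_Integration.integral_diff) auto
    obtain n where n: "n \<in> set_pmf K" "n \<ge> 2" using two by blast
    have "(\<Sum>r<n. b ^ r) - (\<Sum>r<n. a ^ r) = 0"
      by (rule expectation_pmf_eq_0_imp[OF _ _ le n(1)])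
        (use int_geo that in \<open>auto intro!: sum_mono power_mono\<close>)
    moreover have "(\<Sum>r<n. a ^ r) < (\<Sum>r<n. b ^ r)"
      by (rule sum_strict_mono_ex1) (use that n in \<open>auto intro!: power_mono bexI[of _ 1]\<close>)
    ultimately show False by simp
  qed
  have "continuous_on {0..1} \<psi>"
    unfolding continuous_on_sequentially
  proof (intro allI ballI impI, elim conjE)
    fix u :: "nat \<Rightarrow> real" and a assume a: "a \<in> {0..1}" and u: "\<forall>n. u n \<in> {0..1}" "u \<longlonglongrightarrow> a"
    show "(\<psi> \<circ> u) \<longlonglongrightarrow> \<psi> a"
      unfolding \<psi>_def comp_def
      by (rule integral_dominated_convergence[OF _ _ int])
        (use u geo_bound in \<open>auto intro!: tendsto_sum tendsto_power\<close>)
  qed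
  moreover have "\<psi> 0 \<le> 1"
  proof -
    have "\<psi> 0 \<le> measure_pmf.expectation K (\<lambda>_. 1)"
      unfolding \<psi>_def
      by (intro expectation_pmf_mono int_geo) (auto simp: power_0_left sum.delta)
    thus ?thesis by simp
  qed
  moreover have "1 < \<psi> 1" using mean by (simp add: \<psi>_def)
  ultimately obtain a where a: "0 \<le> a" "a \<le> 1" "\<psi> a = 1"
    using IVT'[of \<psi> 0 1 1] by auto
  have "a \<noteq> 1" using a \<open>1 < \<psi> 1\<close> by auto
  \<comment> \<open>A root at 0 would make the expectation of \<open>0 ^ n\<close> vanish; but that
    is the probability of the value 0, positive by \<open>zero\<close>.\<close>
  moreover have "a \<noteq> 0"
  proof
    assume "a = 0"
    hence "measure_pmf.expectation K (\<lambda>n. 0 ^ n) \<le> (0::real)" using key[of 0] a by simp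
    have "(0::real) ^ 0 = 0"
      by (rule expectation_pmf_eq_0_imp[OF _ _ \<open>_ \<le> 0\<close> zero])
        (auto intro!: measure_pmf_integrable_bounded[where C = 1] simp: power_0_left)
    thus False by simp
  qed
  ultimately have a': "0 < a" "a < 1" using a by auto
  show ?thesis
  proof (rule ex1I[of _ a])
    show "0 < a \<and> a < 1 \<and> a = measure_pmf.expectation K (\<lambda>n. a ^ n)"
      using a' a(3) key[of a] by auto
  next
    fix b :: real assume b: "0 < b \<and> b < 1 \<and> b = measure_pmf.expectation K (\<lambda>n. b ^ n)"
    hence "b = 1 - (1 - b) * \<psi> b" using key[of b] by simp
    hence "(1 - b) * (\<psi> b - 1) = 0" by argo
    hence "\<psi> b = 1" using b by simp
    thus "b = a" using strict[of a b] strict[of b a] a a' b by (cases a b rule: linorder_cases) auto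
  qed
qed

subsection \<open>Visits of a discrete Markov chain to a set\<close>

text \<open>The law of the list of states at times 0 to \<open>N\<close>, built from the front so
  that the recursion is the decomposition at the first step.\<close>

primrec paths :: "('s \<Rightarrow> 's pmf) \<Rightarrow> nat \<Rightarrow> 's \<Rightarrow> 's list pmf" where
  "paths K 0 x = return_pmf [x]"
| "paths K (Suc N) x = bind_pmf (K x) (\<lambda>y. map_pmf (Cons x) (paths K N y))"

definition visit_tail :: "('s \<Rightarrow> 's pmf) \<Rightarrow> 's set \<Rightarrow> nat \<Rightarrow> nat \<Rightarrow> 's \<Rightarrow> real" where
  "visit_tail K B N m x = measure (paths K N x) {w. m \<le> length (filter (\<lambda>s. s \<in> B) w)}"

text \<open>The product formula for finite-dimensional laws, stated for a list read off from
  \<open>w\<close> so that it matches the history probabilities of a realisation.\<close>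

lemma pmf_paths:
  "pmf (paths K N x) (map w [0..<Suc N])
     = of_bool (w 0 = x) * (\<Prod>i<N. pmf (K (w i)) (w (Suc i)))"
proof (induction N arbitrary: x w)
  case 0
  show ?case by simp
next
  case (Suc N)
  have w: "map w [0..<Suc (Suc N)] = w 0 # map (w \<circ> Suc) [0..<Suc N]"
    by (subst upt_conv_Cons) (simp_all add: map_Suc_upt[symmetric] del: upt_Suc)
  have cons: "pmf (map_pmf (Cons x) (paths K N y)) (map w [0..<Suc (Suc N)])
      = of_bool (w 0 = x) * (indicator {w 1} y * (\<Prod>i<N. pmf (K (w (Suc i))) (w (Suc (Suc i)))))" for y
  proof (cases "w 0 = x")
    case True
    hence "pmf (map_pmf (Cons x) (paths K N y)) (map w [0..<Suc (Suc N)])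
        = pmf (paths K N y) (map (w \<circ> Suc) [0..<Suc N])"
      unfolding w by (simp add: pmf_map_inj' del: upt_Suc)
    thus ?thesis unfolding Suc.IH using True by (auto simp: indicator_def)
  next
    case False
    thus ?thesis unfolding w by (subst pmf_map_outside) (auto simp del: upt_Suc)
  qed
  show ?case
    by (simp add: pmf_bind cons prod.lessThan_Suc_shift measure_pmf_single del: upt_Suc map_Suc_upt prod.lessThan_Suc)
qed

lemma visit_tail_0: "visit_tail K B 0 m x = of_bool (m \<le> of_bool (x \<in> B))"
  by (simp add: visit_tail_def indicator_def)

text \<open>Decomposition at the first step. Time 0 is counted, so a start in \<open>B\<close> uses
  up one of the \<open>m\<close> visits; for \<open>m = 0\<close> truncated subtraction keeps the
  trivial requirement.\<close>

lemma visit_tail_Suc: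
  "visit_tail K B (Suc N) m x
     = measure_pmf.expectation (K x) (visit_tail K B N (m - of_bool (x \<in> B)))"
proof -
  have cons: "Cons x -` {w. m \<le> length (filter (\<lambda>s. s \<in> B) w)}
      = {w. m - of_bool (x \<in> B) \<le> length (filter (\<lambda>s. s \<in> B) w)}"
    by auto
  have bind: "measure (bind_pmf M N) X = measure_pmf.expectation M (\<lambda>y. measure (N y) X)"
    for M :: "'s pmf" and N :: "'s \<Rightarrow> 's list pmf" and X
    unfolding measure_pmf_bind
    by (rule measure_pmf.measure_bind[where N = "count_space UNIV"])
      (auto simp: space_subprob_algebra measure_pmf.subprob_space_axioms)
  show ?thesis
    unfolding visit_tail_def[abs_def] paths.simps bind measure_map_pmf cons ..
qed

lemma visit_tail_nonneg: "0 \<le> visit_tail K B N m x"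
  and visit_tail_le_1: "visit_tail K B N m x \<le> 1"
  by (simp_all add: visit_tail_def)

lemma visit_tail_zero: "visit_tail K B N 0 = (\<lambda>_. 1)"
  by (simp add: visit_tail_def[abs_def])

text \<open>Since \<open>paths\<close> grows at the front, a longer path is not compared with its
  prefix; monotonicity in the horizon passes through the first-step recursion, for all
  \<open>m\<close> and \<open>x\<close> at once.\<close>

lemma visit_tail_step_mono: "visit_tail K B N m x \<le> visit_tail K B (Suc N) m x"
proof (induction N arbitrary: m x)
  case 0
  show ?case
  proof (cases "m \<le> of_bool (x \<in> B)")
    case True
    hence "m - of_bool (x \<in> B) = 0" by simp
    thus ?thesis by (simp only: visit_tail_Suc visit_tail_zero) (simp add: visit_tail_le_1)
  next
    case False
    thus ?thesis by (simp add: visit_tail_0 visit_tail_nonneg)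
  qed
next
  case (Suc N)
  let ?m = "m - of_bool (x \<in> B)"
  have "measure_pmf.expectation (K x) (visit_tail K B N ?m)
      \<le> measure_pmf.expectation (K x) (visit_tail K B (Suc N) ?m)"
    by (intro expectation_pmf_mono Suc.IH measure_pmf_integrable_bounded[where C = 1])
      (simp_all add: visit_tail_nonneg visit_tail_le_1)
  thus ?case
    by (simp only: visit_tail_Suc[of K B _ m x])
qed

text \<open>The limit exists by monotonicity in the horizon and is the probability of at least
  \<open>m\<close> visits over all times.\<close>

definition visit_prob :: "('s \<Rightarrow> 's pmf) \<Rightarrow> 's set \<Rightarrow> nat \<Rightarrow> 's \<Rightarrow> real" where
  "visit_prob K B m x = lim (\<lambda>N. visit_tail K B N m x)"

lemma visit_tail_tendsto: "(\<lambda>N. visit_tail K B N m x) \<longlonglongrightarrow> visit_prob K B m x"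
proof -
  have "Bseq (\<lambda>N. visit_tail K B N m x)"
    by (rule BseqI'[of _ 1]) (simp add: visit_tail_nonneg visit_tail_le_1)
  moreover have "incseq (\<lambda>N. visit_tail K B N m x)"
    by (rule incseq_SucI) (rule visit_tail_step_mono)
  ultimately have "convergent (\<lambda>N. visit_tail K B N m x)"
    by (intro Bseq_monoseq_convergent) (auto simp: monoseq_def incseq_def)
  thus ?thesis
    by (simp add: convergent_LIMSEQ_iff visit_prob_def)
qed

lemma visit_prob_nonneg: "0 \<le> visit_prob K B m x"
  by (rule LIMSEQ_le_const[OF visit_tail_tendsto]) (simp add: visit_tail_nonneg)

lemma visit_prob_le_1: "visit_prob K B m x \<le> 1"
  by (rule LIMSEQ_le_const2[OF visit_tail_tendsto]) (simp add: visit_tail_le_1)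

lemma visit_prob_step:
  "visit_prob K B m x = measure_pmf.expectation (K x) (visit_prob K B (m - of_bool (x \<in> B)))"
proof (rule LIMSEQ_unique)
  show "(\<lambda>N. visit_tail K B (Suc N) m x) \<longlonglongrightarrow> visit_prob K B m x"
    by (rule LIMSEQ_Suc[OF visit_tail_tendsto])
  show "(\<lambda>N. visit_tail K B (Suc N) m x)
      \<longlonglongrightarrow> measure_pmf.expectation (K x) (visit_prob K B (m - of_bool (x \<in> B)))"
    unfolding visit_tail_Suc
    by (rule integral_dominated_convergence[where w = "\<lambda>_. 1"])
      (simp_all add: visit_tail_tendsto visit_tail_nonneg visit_tail_le_1)
qed

lemma visit_prob_0: "visit_prob K B 0 = (\<lambda>_. 1)"
  by (simp add: visit_prob_def[abs_def] visit_tail_zero)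

lemma visit_prob_1: "x \<in> B \<Longrightarrow> visit_prob K B 1 x = 1"
  by (subst visit_prob_step) (simp add: visit_prob_0)

subsection \<open>The quadrant walk\<close>

definition jump_pmf :: "(int \<times> int) pmf \<Rightarrow> (int \<times> int) pmf \<Rightarrow> (int \<times> int) pmf \<Rightarrow> (int \<times> int) pmf
    \<Rightarrow> nat \<times> nat \<Rightarrow> (int \<times> int) pmf" where
  "jump_pmf P H V Q = (\<lambda>(i, j). if i > 0 \<and> j > 0 then P else if i > 0 then H else if j > 0 then V else Q)"

text \<open>\<open>nat\<close> would clip a negative coordinate to 0; under the jump bounds imposed
  later no step leaves the quadrant.\<close>

definition quadrant_step :: "(int \<times> int) pmf \<Rightarrow> (int \<times> int) pmf \<Rightarrow> (int \<times> int) pmf \<Rightarrow> (int \<times> int) pmf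
    \<Rightarrow> nat \<times> nat \<Rightarrow> (nat \<times> nat) pmf" where
  "quadrant_step P H V Q = (\<lambda>(i, j).
     map_pmf (\<lambda>(k, l). (nat (int i + k), nat (int j + l))) (jump_pmf P H V Q (i, j)))"

section \<open>Exchange of the two coordinates\<close>

abbreviation swap_pmf :: "('a \<times> 'b) pmf \<Rightarrow> ('b \<times> 'a) pmf" where
  "swap_pmf \<equiv> map_pmf prod.swap"

text \<open>Exchanging the coordinates also exchanges the axes, hence \<open>H\<close> and
  \<open>V\<close> change places.\<close>

lemma quadrant_step_swap:
  "quadrant_step (swap_pmf P) (swap_pmf V) (swap_pmf H) (swap_pmf Q) (j, i)
     = swap_pmf (quadrant_step P H V Q (i, j))"
  by (auto simp: quadrant_step_def jump_pmf_def pmf.map_comp o_def case_prod_unfold)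

lemma visit_tail_swap:
  "visit_tail (quadrant_step (swap_pmf P) (swap_pmf V) (swap_pmf H) (swap_pmf Q)) boundary N m (j, i)
     = visit_tail (quadrant_step P H V Q) boundary N m (i, j)"
proof (induction N arbitrary: m i j)
  case 0
  show ?case by (auto simp: visit_tail_0 boundary_def)
next
  case (Suc N)
  let ?K = "quadrant_step P H V Q"
    and ?K' = "quadrant_step (swap_pmf P) (swap_pmf V) (swap_pmf H) (swap_pmf Q)"
  have "(j, i) \<in> boundary \<longleftrightarrow> (i, j) \<in> boundary" by (auto simp: boundary_def)
  moreover have "visit_tail ?K' boundary N m (prod.swap y) = visit_tail ?K boundary N m y" for m y
    by (cases y) (simp add: Suc.IH)
  ultimately show ?case
    unfolding visit_tail_Suc quadrant_step_swap integral_map_pmf by simp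
qed

lemma visit_prob_swap:
  "visit_prob (quadrant_step (swap_pmf P) (swap_pmf V) (swap_pmf H) (swap_pmf Q)) boundary m (j, i)
     = visit_prob (quadrant_step P H V Q) boundary m (i, j)"
  by (simp add: visit_prob_def visit_tail_swap)

text \<open>The least site attaining a positive maximum steps down with positive probability, so by
  subharmonicity the maximum would also be attained one site below it.\<close>

lemma discrete_maximum_principle:
  fixes D :: "nat \<Rightarrow> real" and P :: "(int \<times> int) pmf"
  assumes zero: "D 0 \<le> 0"
    and lim: "D \<longlonglongrightarrow> 0"
    and sub: "\<And>j. 0 < j \<Longrightarrow> D j \<le> measure_pmf.expectation P (\<lambda>(k, l). D (nat (int j + l)))"
    and down: "(k, -1) \<in> set_pmf P"
  shows "D j \<le> 0"
proof (rule ccontr)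
  assume "\<not> D j \<le> 0"
  hence Dj: "D j > 0" by simp
  \<comment> \<open>As \<open>D\<close> tends to 0, all values from \<open>N\<close> on lie below
    \<open>D j\<close>, so the supremum is attained on an initial segment.\<close>
  obtain N where N: "\<And>i. i \<ge> N \<Longrightarrow> D i < D j"
    using order_tendstoD(2)[OF lim Dj] by (auto simp: eventually_sequentially)
  define mx where "mx = Max (D ` {..max N j})"
  have mx_ge: "D i \<le> mx" for i
  proof (cases "i \<le> max N j")
    case True
    thus ?thesis by (simp add: mx_def)
  next
    case False
    hence "D i < D j" using N by simp
    also have "D j \<le> mx" by (simp add: mx_def)
    finally show ?thesis by simp
  qed
  have mx_pos: "mx > 0" using Dj mx_ge[of j] by simp
  define i where "i = (LEAST i. D i = mx)"
  have "mx \<in> D ` {..max N j}" unfolding mx_def by (rule Max_in) auto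
  hence i: "D i = mx" unfolding i_def by (metis (mono_tags, lifting) LeastI imageE)
  have "i > 0" using i zero mx_pos by (cases i) auto
  have bdd: "\<exists>C. \<forall>i. \<bar>D i\<bar> \<le> C"
    using convergent_imp_bounded[OF lim] by (auto simp: bounded_iff)
  then obtain C where C: "\<And>i. \<bar>D i\<bar> \<le> C" by blast
  have intD: "integrable (measure_pmf P) (\<lambda>(k, l). D (nat (int i + l)))"
    by (rule measure_pmf_integrable_bounded[where C = C]) (auto simp: C)
  have "measure_pmf.expectation P (\<lambda>(k, l). mx - D (nat (int i + l))) \<le> 0"
    using sub[OF \<open>i > 0\<close>] i intD by (simp add: case_prod_unfold)
  from expectation_pmf_eq_0_imp[OF _ _ this down] have "D (nat (int i + -1)) = mx"
    using intD mx_ge by (auto simp: case_prod_unfold)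
  moreover have "nat (int i + -1) < i" using \<open>i > 0\<close> by simp
  ultimately show False unfolding i_def by (metis not_less_Least)
qed

section \<open>Exponential functions under one step of the walk\<close>

lemma expectation_quadrant_step:
  "measure_pmf.expectation (quadrant_step P H V Q (i, j)) g
     = measure_pmf.expectation (jump_pmf P H V Q (i, j)) (\<lambda>(k, l). g (nat (int i + k), nat (int j + l)))"
  for g :: "nat \<times> nat \<Rightarrow> real"
  by (simp add: quadrant_step_def case_prod_unfold)

lemma power_nat_shift:
  fixes a :: real
  assumes "a \<noteq> 0" "0 \<le> int i + k"
  shows "a ^ nat (int i + k) = a ^ i * a powi k"
proof -
  have "a ^ nat (int i + k) = a powi (int i + k)"
    using assms by (simp add: power_int_def)
  thus ?thesis using assms by (simp add: power_int_add)
qed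

text \<open>\<open>P_a\<close> and \<open>P_b\<close> make \<open>a ^ i\<close> and
  \<open>b ^ j\<close> harmonic for interior steps. The assumptions are symmetric in the two axes,
  so the locale can be interpreted a second time with the axes exchanged.\<close>

locale quadrant_kernel =
  fixes P H V Q :: "(int \<times> int) pmf" and a b :: real
  assumes P_ge: "\<And>k l. (k, l) \<in> set_pmf P \<Longrightarrow> - 1 \<le> k \<and> - 1 \<le> l"
    and boundary_ge: "\<And>k l. (k, l) \<in> set_pmf H \<union> set_pmf V \<union> set_pmf Q \<Longrightarrow> 0 \<le> k \<and> 0 \<le> l"
    and a: "0 < a" "a < 1"
    and b: "0 < b" "b < 1"
    and P_a: "measure_pmf.expectation P (\<lambda>(k, l). a powi k) = 1"
    and P_b: "measure_pmf.expectation P (\<lambda>(k, l). b powi l) = 1"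
    and P_left: "\<exists>l. (- 1, l) \<in> set_pmf P"
    and P_down: "\<exists>k. (k, - 1) \<in> set_pmf P"
begin

abbreviation "K \<equiv> quadrant_step P H V Q"
abbreviation "T \<equiv> visit_prob K boundary"

definition ht :: real where
  "ht = measure_pmf.expectation H (\<lambda>(k, l). b powi l)"

lemma powi_le_inverse:
  fixes c :: real
  assumes "0 < c" "c < 1" "- 1 \<le> k"
  shows "\<bar>c powi k\<bar> \<le> 1 / c"
proof -
  have "c powi k \<le> c powi (-1)"
    using assms by (intro power_int_decreasing) auto
  thus ?thesis using assms by (simp add: power_int_minus field_simps)
qed

lemma powi_le_1:
  fixes c :: real
  assumes "0 < c" "c < 1" "0 \<le> k"
  shows "c powi k \<le> 1"
  using power_int_decreasing[of 0 k c] assms by auto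

lemma P_integrable:
  "integrable (measure_pmf P) (\<lambda>(k, l). a powi k)" "integrable (measure_pmf P) (\<lambda>(k, l). b powi l)"
  by (rule measure_pmf_integrable_bounded[where C = "1 / a"], use a powi_le_inverse P_ge in force)
    (rule measure_pmf_integrable_bounded[where C = "1 / b"], use b powi_le_inverse P_ge in force)

lemma H_integrable:
  "integrable (measure_pmf H) (\<lambda>(k, l). a powi k)" "integrable (measure_pmf H) (\<lambda>(k, l). b powi l)"
  by (rule measure_pmf_integrable_bounded[where C = 1], use a powi_le_1 boundary_ge in force)
    (rule measure_pmf_integrable_bounded[where C = 1], use b powi_le_1 boundary_ge in force)

lemma ht_bounds: "0 \<le> ht" "ht \<le> 1"
proof -
  show "0 \<le> ht" unfolding ht_def using b by (intro integral_nonneg_AE) auto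
  have "ht \<le> measure_pmf.expectation H (\<lambda>_. 1)"
    unfolding ht_def using b powi_le_1 boundary_ge
    by (intro expectation_pmf_mono H_integrable) auto
  thus "ht \<le> 1" by simp
qed

lemma H_a_le_1: "measure_pmf.expectation H (\<lambda>(k, l). a powi k) \<le> 1"
proof -
  have "measure_pmf.expectation H (\<lambda>(k, l). a powi k) \<le> measure_pmf.expectation H (\<lambda>_. 1)"
    using a powi_le_1 boundary_ge by (intro expectation_pmf_mono H_integrable) auto
  thus ?thesis by simp
qed

text \<open>A jump of at least -1 from a positive coordinate is never clipped by \<open>nat\<close>,
  so \<open>P_a\<close> and \<open>P_b\<close> apply. The free coefficients serve the upper bound
  with \<open>d = 1\<close> and the lower one with \<open>d = -1\<close>.\<close>

lemma expectation_interior: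
  assumes "0 < i" "0 < j"
  shows "measure_pmf.expectation (K (i, j)) (\<lambda>(i', j'). c * b ^ j' + d * a ^ i') = c * b ^ j + d * a ^ i"
proof -
  have "measure_pmf.expectation (K (i, j)) (\<lambda>(i', j'). c * b ^ j' + d * a ^ i')
      = measure_pmf.expectation P (\<lambda>x. c * b ^ j * (case x of (k, l) \<Rightarrow> b powi l)
          + d * a ^ i * (case x of (k, l) \<Rightarrow> a powi k))"
    unfolding expectation_quadrant_step jump_pmf_def using assms a b P_ge
    by (simp add: case_prod_unfold) (intro expectation_pmf_cong, force simp: power_nat_shift)
  also have "\<dots> = c * b ^ j + d * a ^ i"
    using P_integrable P_a P_b by simp
  finally show ?thesis .
qed

text \<open>From height 0 the new height is the vertical jump itself, so \<open>b ^ j'\<close>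
  averages to \<open>ht\<close>. The horizontal factor is bounded by 1 later, through
  \<open>H_a_le_1\<close>.\<close>

lemma expectation_axis:
  assumes "0 < i"
  shows "measure_pmf.expectation (K (i, 0)) (\<lambda>(i', j'). c * b ^ j' + d * a ^ i')
    = c * ht + d * a ^ i * measure_pmf.expectation H (\<lambda>(k, l). a powi k)"
proof -
  have "measure_pmf.expectation (K (i, 0)) (\<lambda>(i', j'). c * b ^ j' + d * a ^ i')
      = measure_pmf.expectation H (\<lambda>x. c * (case x of (k, l) \<Rightarrow> b powi l)
          + d * a ^ i * (case x of (k, l) \<Rightarrow> a powi k))"
    unfolding expectation_quadrant_step jump_pmf_def using assms a b boundary_ge
    by (simp add: case_prod_unfold)
      (intro expectation_pmf_cong, force simp: power_nat_shift power_int_def)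
  also have "\<dots> = c * ht + d * a ^ i * measure_pmf.expectation H (\<lambda>(k, l). a powi k)"
    using H_integrable by (simp add: ht_def)
  finally show ?thesis .
qed

lemma integrable_powers:
  "integrable (measure_pmf M) (\<lambda>(i, j). c * b ^ j + d * a ^ i)" for M :: "(nat \<times> nat) pmf"
proof (rule measure_pmf_integrable_bounded[where C = "\<bar>c\<bar> + \<bar>d\<bar>"], clarify)
  fix i j
  have "\<bar>c * b ^ j\<bar> \<le> \<bar>c\<bar>" "\<bar>d * a ^ i\<bar> \<le> \<bar>d\<bar>"
    using a b by (auto simp: abs_mult mult_left_le power_le_one)
  thus "\<bar>c * b ^ j + d * a ^ i\<bar> \<le> \<bar>c\<bar> + \<bar>d\<bar>" by linarith
qed

section \<open>Upper and lower estimates with error \<open>a ^ i\<close>\<close>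

lemma integrable_visit_tail: "integrable (measure_pmf M) (visit_tail K boundary N m)"
  by (rule measure_pmf_integrable_bounded[where C = 1]) (simp add: visit_tail_nonneg visit_tail_le_1)

lemma integrable_visit_prob: "integrable (measure_pmf M) (T m)"
  by (rule measure_pmf_integrable_bounded[where C = 1]) (simp add: visit_prob_nonneg visit_prob_le_1)

text \<open>The bound is at least 1 on the vertical axis and, for \<open>m = 1\<close>, on the
  horizontal one; it is harmonic in the interior. On the horizontal axis with
  \<open>m \<ge> 2\<close> the contact lowers \<open>m\<close> by one and the next jump supplies the
  factor \<open>ht\<close>.\<close>

lemma visit_tail_upper:
  assumes "1 \<le> m"
  shows "visit_tail K boundary N m (i, j) \<le> ht ^ (m - 1) * b ^ j + a ^ i"
  using assms
proof (induction N arbitrary: i j m)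
  case 0
  thus ?case using a b ht_bounds by (auto simp: visit_tail_0 boundary_def)
next
  case (Suc N)
  have pos: "0 \<le> ht ^ (m - 1) * b ^ j" using b ht_bounds by simp
  have mono: "measure_pmf.expectation (K (i, j)) (visit_tail K boundary N m')
      \<le> measure_pmf.expectation (K (i, j)) (\<lambda>(i', j'). ht ^ (m' - 1) * b ^ j' + 1 * a ^ i')"
    if "1 \<le> m'" for m'
    using Suc.IH[OF that] by (intro expectation_pmf_mono integrable_powers integrable_visit_tail) auto
  consider "i = 0" | "0 < i" "0 < j" | "0 < i" "j = 0" "m = 1" | "0 < i" "j = 0" "2 \<le> m"
    using Suc.prems by linarith
  thus ?case
  proof cases
    case 1
    thus ?thesis using visit_tail_le_1[of K boundary "Suc N" m "(i, j)"] pos by simp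
  next
    case 2
    thus ?thesis using mono[OF Suc.prems] expectation_interior[of i j "ht ^ (m - 1)" 1]
      by (simp add: visit_tail_Suc boundary_def)
  next
    case 3
    thus ?thesis using visit_tail_le_1[of K boundary "Suc N" m "(i, j)"] a
      by (simp add: add_increasing2)
  next
    case 4
    have "ht ^ (m - 1 - 1) * ht = ht ^ (m - 1)"
      using 4 by (simp add: power_Suc2[symmetric] Suc_diff_Suc numeral_2_eq_2 del: power_Suc)
    moreover have "a ^ i * measure_pmf.expectation H (\<lambda>(k, l). a powi k) \<le> a ^ i"
      using H_a_le_1 a by (simp add: mult_left_le)
    moreover have "1 \<le> m - 1" using 4 by simp
    note mono[OF this]
    ultimately show ?thesis
      using 4 expectation_axis[of i "ht ^ (m - 1 - 1)" 1]
      by (simp add: visit_tail_Suc boundary_def)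
  qed
qed

lemma visit_prob_upper:
  assumes "1 \<le> m"
  shows "T m (i, j) \<le> ht ^ (m - 1) * b ^ j + a ^ i"
  by (rule LIMSEQ_le_const2[OF visit_tail_tendsto]) (use visit_tail_upper[OF assms] in blast)

text \<open>The defect is subharmonic off the axes and nonpositive on them, but it need not vanish at
  infinity along horizontal lines. Its supremum over each horizontal line does decay with the height,
  so the one-dimensional maximum principle applies to that supremum.\<close>

lemma visit_prob_lower:
  assumes "1 \<le> m"
  shows "ht ^ (m - 1) * b ^ j - a ^ i \<le> T m (i, j)"
  using assms
proof (induction m arbitrary: i j rule: less_induct)
  case (less m)
  define c where "c = ht ^ (m - 1)"
  have c: "0 \<le> c" "c \<le> 1" using ht_bounds by (auto simp: c_def power_le_one)
  define D where "D i j = c * b ^ j - a ^ i - T m (i, j)" for i j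
  have D_le: "D i j \<le> b ^ j" for i j
  proof -
    have "c * b ^ j \<le> b ^ j" using c b by (simp add: mult_left_le_one_le)
    moreover have "0 \<le> a ^ i" using a by simp
    ultimately show ?thesis using visit_prob_nonneg[of K boundary m "(i, j)"] by (simp add: D_def)
  qed
  have b_le: "b ^ j \<le> 1" for j using b by (simp add: power_le_one)
  have D_vertical: "D 0 j \<le> 0" for j
  proof -
    have "c * b ^ j \<le> 1" using c b b_le by (intro mult_le_one) auto
    thus ?thesis using visit_prob_nonneg[of K boundary m "(0, j)"] by (simp add: D_def)
  qed
  \<comment> \<open>For \<open>m = 1\<close> the contact at the start gives
    \<open>T m (i, 0) = 1\<close>. For \<open>m \<ge> 2\<close> it reduces the claim to
    \<open>m - 1\<close>, and averaging the induction hypothesis over a jump from the axis yields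
    the missing factor \<open>ht\<close>.\<close>
  have D_horizontal: "D i 0 \<le> 0" for i
  proof -
    consider "i = 0" | "m = 1" | "0 < i" "2 \<le> m" using less.prems by linarith
    thus ?thesis
    proof cases
      case 1
      thus ?thesis using D_vertical by simp
    next
      case 2
      hence "T m (i, 0) = 1" using visit_prob_1[of "(i, 0)" boundary K] by (simp add: boundary_def)
      moreover have "0 \<le> a ^ i" using a by simp
      ultimately show ?thesis using c by (simp add: D_def)
    next
      case 3
      have "measure_pmf.expectation (K (i, 0)) (\<lambda>(i', j'). ht ^ (m - 1 - 1) * b ^ j' + (-1) * a ^ i')
          \<le> measure_pmf.expectation (K (i, 0)) (T (m - 1))"
        using less.IH[of "m - 1"] 3
        by (intro expectation_pmf_mono integrable_powers integrable_visit_prob) auto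
      moreover have "ht ^ (m - 1 - 1) * ht = c"
        using 3 by (simp add: c_def power_Suc2[symmetric] Suc_diff_Suc numeral_2_eq_2 del: power_Suc)
      moreover have "a ^ i * measure_pmf.expectation H (\<lambda>(k, l). a powi k) \<le> a ^ i"
        using H_a_le_1 a by (simp add: mult_left_le)
      moreover have "T m (i, 0) = measure_pmf.expectation (K (i, 0)) (T (m - 1))"
        by (subst visit_prob_step) (simp add: boundary_def)
      ultimately show ?thesis
        using 3 expectation_axis[of i "ht ^ (m - 1 - 1)" "-1"] by (simp add: D_def)
    qed
  qed
  define E where "E j = (SUP i. max 0 (D i j))" for j
  have bdd: "bdd_above (range (\<lambda>i. max 0 (D i j)))" for j
    by (rule bdd_aboveI2[of _ _ "b ^ j"]) (use D_le b in auto)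
  have E_ge: "max 0 (D i j) \<le> E j" for i j
    unfolding E_def by (rule cSUP_upper[OF _ bdd]) simp
  have E_le: "E j \<le> b ^ j" for j
    unfolding E_def by (rule cSUP_least) (use D_le b in auto)
  have E_nonneg: "0 \<le> E j" for j using E_ge[of 0 j] by simp
  have E_bound: "\<bar>E j\<bar> \<le> 1" for j using E_nonneg[of j] E_le[of j] b_le[of j] by simp
  have D_step: "D i j \<le> measure_pmf.expectation P (\<lambda>(k, l). E (nat (int j + l)))"
    if ij: "0 < i" "0 < j" for i j
  proof -
    have T: "T m (i, j) = measure_pmf.expectation (K (i, j)) (T m)"
      by (subst visit_prob_step) (use ij in \<open>simp add: boundary_def\<close>)
    have "D i j = measure_pmf.expectation (K (i, j)) (\<lambda>(i', j'). c * b ^ j' + (-1) * a ^ i')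
        - measure_pmf.expectation (K (i, j)) (T m)"
      unfolding expectation_interior[OF ij] T[symmetric] by (simp add: D_def)
    also have "\<dots> = measure_pmf.expectation (K (i, j))
        (\<lambda>x. (case x of (i', j') \<Rightarrow> c * b ^ j' + (-1) * a ^ i') - T m x)"
      by (rule Bochner_Integration.integral_diff[symmetric])
        (rule integrable_powers integrable_visit_prob)+
    \<comment> \<open>Bounding the defect at the new site by its supremum along that row removes the
      horizontal coordinate; only the vertical jump remains.\<close>
    also have "\<dots> \<le> measure_pmf.expectation (K (i, j)) (\<lambda>(i', j'). E j')"
    proof (intro expectation_pmf_mono Bochner_Integration.integrable_diff
        integrable_powers integrable_visit_prob)
      show "integrable (measure_pmf (K (i, j))) (\<lambda>(i', j'). E j')"
        by (rule measure_pmf_integrable_bounded[where C = 1]) (use E_bound in auto)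
      show "(case x of (i', j') \<Rightarrow> c * b ^ j' + (-1) * a ^ i') - T m x \<le> (case x of (i', j') \<Rightarrow> E j')" for x
        using E_ge[of "fst x" "snd x"] by (cases x) (simp add: D_def)
    qed
    also have "\<dots> = measure_pmf.expectation P (\<lambda>(k, l). E (nat (int j + l)))"
      using ij by (simp add: expectation_quadrant_step jump_pmf_def case_prod_unfold)
    finally show ?thesis .
  qed
  obtain k where k: "(k, -1) \<in> set_pmf P" using P_down by blast
  have "E j \<le> 0" for j
  proof (rule discrete_maximum_principle[OF _ _ _ k])
    show "E 0 \<le> 0" unfolding E_def by (rule cSUP_least) (use D_horizontal in auto)
    show "E \<longlonglongrightarrow> 0"
    proof (rule tendsto_sandwich[OF _ _ tendsto_const])
      show "(\<lambda>j. b ^ j) \<longlonglongrightarrow> 0" using b by (simp add: LIMSEQ_realpow_zero)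
    qed (use E_nonneg E_le in auto)
    fix j :: nat assume j: "0 < j"
    have "0 \<le> measure_pmf.expectation P (\<lambda>(k, l). E (nat (int j + l)))"
      using E_nonneg by (intro integral_nonneg_AE) (auto simp: case_prod_unfold)
    moreover from this have "D i j \<le> measure_pmf.expectation P (\<lambda>(k, l). E (nat (int j + l)))" for i
      using D_step[OF _ j, of i] D_vertical[of j] by (cases "i = 0") auto
    ultimately show "E j \<le> measure_pmf.expectation P (\<lambda>(k, l). E (nat (int j + l)))"
      unfolding E_def[of j] by (intro cSUP_least) auto
  qed
  hence "D i j \<le> 0" using E_ge[of i j] by (meson max.boundedE order_trans)
  thus ?case by (simp add: D_def c_def)
qed

section \<open>Exactly \<open>n\<close> contacts, and the combination of both axes\<close>

lemma visit_prob_diff_horizontal: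
  assumes "1 \<le> n"
  shows "\<bar>T n (i, j) - T (Suc n) (i, j) - (1 - ht) * ht ^ (n - 1) * b ^ j\<bar> \<le> 2 * a ^ i"
proof -
  \<comment> \<open>The tail for \<open>Suc n\<close> carries the exponent \<open>n\<close>; each of
    the two tails contributes an error \<open>a ^ i\<close>.\<close>
  have "ht ^ n = ht ^ (n - 1) * ht" using assms by (cases n) auto
  hence "(1 - ht) * ht ^ (n - 1) * b ^ j = ht ^ (n - 1) * b ^ j - ht ^ n * b ^ j"
    by (simp add: algebra_simps)
  thus ?thesis
    using visit_prob_upper[OF assms, of i j] visit_prob_lower[OF assms, of j i]
      visit_prob_upper[of "Suc n" i j] visit_prob_lower[of "Suc n" j i] by simp
qed

text \<open>\<open>V\<close> and \<open>a\<close> take the roles of \<open>H\<close> and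
  \<open>b\<close>, so the estimate at the horizontal axis also yields the one at the vertical
  axis.\<close>

interpretation swapped: quadrant_kernel "swap_pmf P" "swap_pmf V" "swap_pmf H" "swap_pmf Q" b a
proof
  show "measure_pmf.expectation (swap_pmf P) (\<lambda>(k, l). b powi k) = 1"
    "measure_pmf.expectation (swap_pmf P) (\<lambda>(k, l). a powi l) = 1"
    using P_a P_b by (simp_all add: case_prod_unfold)
qed (use a b P_ge boundary_ge P_left P_down in \<open>force simp: prod.swap_def\<close>)+

definition vt :: real where
  "vt = measure_pmf.expectation V (\<lambda>(k, l). a powi k)"

lemma swapped_ht: "swapped.ht = vt"
  unfolding swapped.ht_def vt_def by (simp add: case_prod_unfold)

lemma visit_prob_diff_vertical:
  assumes "1 \<le> n"
  shows "\<bar>T n (i, j) - T (Suc n) (i, j) - (1 - vt) * vt ^ (n - 1) * a ^ i\<bar> \<le> 2 * b ^ j"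
  using swapped.visit_prob_diff_horizontal[OF assms, of j i]
  by (simp add: visit_prob_swap swapped_ht)

text \<open>The larger coordinate is at least half the sum. If it is \<open>i\<close>, the
  horizontal estimate costs \<open>2 * a ^ i\<close> and the term of the other axis at most
  \<open>a ^ i\<close>, whence the constant 3; the case of \<open>j\<close> is symmetric.\<close>

lemma visit_prob_diff:
  assumes "1 \<le> n"
  shows "\<bar>T n (i, j) - T (Suc n) (i, j)
      - ((1 - vt) * vt ^ (n - 1) * a ^ i + (1 - ht) * ht ^ (n - 1) * b ^ j)\<bar>
    \<le> 3 * max a b ^ ((i + j) div 2)"
proof -
  have coeff: "0 \<le> (1 - t) * t ^ (n - 1)" "(1 - t) * t ^ (n - 1) \<le> 1" if "0 \<le> t" "t \<le> 1" for t :: real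
    using that by (auto intro!: mult_le_one simp: power_le_one)
  have vt: "0 \<le> vt" "vt \<le> 1" using swapped.ht_bounds by (simp_all add: swapped_ht)
  have term_bound: "\<bar>(1 - t) * t ^ (n - 1) * x\<bar> \<le> x" if "0 \<le> t" "t \<le> 1" "0 \<le> x" for t x :: real
    using coeff[OF that(1,2)] that(3) by (simp add: abs_mult mult_left_le_one_le)
  let ?c = "max a b"
  have c: "0 \<le> ?c" "?c \<le> 1" using a b by auto
  have pow: "x ^ r \<le> ?c ^ ((i + j) div 2)" if "0 \<le> x" "x \<le> ?c" "(i + j) div 2 \<le> r" for x r
  proof -
    have "x ^ r \<le> ?c ^ r" using that by (intro power_mono) auto
    also have "\<dots> \<le> ?c ^ ((i + j) div 2)" using c that by (intro power_decreasing) auto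
    finally show ?thesis .
  qed
  show ?thesis
  proof (cases "j \<le> i")
    case True
    have "a ^ i \<le> ?c ^ ((i + j) div 2)" using a c True by (intro pow) auto
    thus ?thesis
      using visit_prob_diff_horizontal[OF assms, of i j] term_bound[OF vt, of "a ^ i"] a
      by (smt (verit) zero_le_power)
  next
    case False
    have "b ^ j \<le> ?c ^ ((i + j) div 2)" using b c False by (intro pow) auto
    thus ?thesis
      using visit_prob_diff_vertical[OF assms, of i j] term_bound[OF ht_bounds, of "b ^ j"] b
      by (smt (verit) zero_le_power)
  qed
qed

end

subsection \<open>Contacts of a realisation of the walk\<close>

lemma length_paths: "w \<in> set_pmf (paths K N x) \<Longrightarrow> length w = Suc N"
proof (induction N arbitrary: x w)
  case (Suc N)
  then obtain y u where "w = x # u" "u \<in> set_pmf (paths K N y)" by auto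
  thus ?case using Suc.IH by simp
qed simp

text \<open>Counting along the list of states makes this a function of the history, whose law is
  given by \<open>paths\<close>.\<close>

definition visits :: "(nat \<Rightarrow> 'a \<Rightarrow> nat \<times> nat) \<Rightarrow> nat \<Rightarrow> 'a \<Rightarrow> nat" where
  "visits S N \<omega> = length (filter (\<lambda>s. s \<in> boundary) (map (\<lambda>m. S m \<omega>) [0..<Suc N]))"

lemma visits_0: "visits S 0 \<omega> = of_bool (S 0 \<omega> \<in> boundary)"
  and visits_Suc: "visits S (Suc N) \<omega> = visits S N \<omega> + of_bool (S (Suc N) \<omega> \<in> boundary)"
  by (simp_all add: visits_def)

lemma visits_eq_sum: "of_nat (visits S N \<omega>) = (\<Sum>m<Suc N. indicator boundary (S m \<omega>) :: ennreal)"
  by (induction N) (simp_all add: visits_0 visits_Suc indicator_def)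

text \<open>The series may be infinite, so it is reduced to finite horizons. If no horizon reached
  \<open>m = Suc r\<close>, all partial counts would be at most \<open>r\<close>, and so would the
  series.\<close>

lemma contacts_ge_iff: "of_nat m \<le> contacts S \<omega> \<longleftrightarrow> (\<exists>N. m \<le> visits S N \<omega>)"
  and contacts_le_iff: "contacts S \<omega> \<le> of_nat m \<longleftrightarrow> (\<forall>N. visits S N \<omega> \<le> m)"
proof -
  have visits_le: "of_nat (visits S N \<omega>) \<le> contacts S \<omega>" for N
    unfolding visits_eq_sum contacts_def by (rule sum_le_suminf) auto
  have le: "contacts S \<omega> \<le> of_nat m" if "\<And>N. visits S N \<omega> \<le> m" for m
    unfolding contacts_def
  proof (rule suminf_le_const)
    fix N
    have "(\<Sum>i<N. indicator boundary (S i \<omega>) :: ennreal) \<le> of_nat (visits S N \<omega>)"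
      unfolding visits_eq_sum by (rule sum_mono2) auto
    also have "\<dots> \<le> of_nat m" using that by simp
    finally show "(\<Sum>i<N. indicator boundary (S i \<omega>) :: ennreal) \<le> of_nat m" .
  qed simp
  show "contacts S \<omega> \<le> of_nat m \<longleftrightarrow> (\<forall>N. visits S N \<omega> \<le> m)"
    using le visits_le by (meson of_nat_le_iff order_trans)
  show "of_nat m \<le> contacts S \<omega> \<longleftrightarrow> (\<exists>N. m \<le> visits S N \<omega>)"
  proof (cases m)
    case (Suc r)
    show ?thesis
    proof
      assume ge: "of_nat m \<le> contacts S \<omega>"
      show "\<exists>N. m \<le> visits S N \<omega>"
      proof (rule ccontr)
        assume "\<not> ?thesis"
        hence "contacts S \<omega> \<le> of_nat r" using Suc by (intro le) (auto simp: not_le less_Suc_eq_le)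
        with ge have "(of_nat m :: ennreal) \<le> of_nat r" by (rule order_trans)
        thus False using Suc unfolding of_nat_le_iff by simp
      qed
    qed (meson visits_le of_nat_le_iff order_trans)
  qed simp
qed

lemma contacts_eq_iff:
  "contacts S \<omega> = of_nat n \<longleftrightarrow> (\<exists>N. n \<le> visits S N \<omega>) \<and> \<not> (\<exists>N. Suc n \<le> visits S N \<omega>)"
proof -
  have "contacts S \<omega> = of_nat n \<longleftrightarrow> of_nat n \<le> contacts S \<omega> \<and> contacts S \<omega> \<le> of_nat n"
    by (rule order_eq_iff[THEN trans]) (rule conj_commute)
  thus ?thesis
    unfolding contacts_ge_iff contacts_le_iff by (simp add: not_less_eq_eq)
qed

context reflected_walk
begin

section \<open>The law of the history of a realisation\<close>

lemma measurable_S_set [measurable]: "{\<omega> \<in> space M. \<forall>m\<le>n. S m \<omega> = w m} \<in> events"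
  using S_measurable by measurable

lemma prob_history:
  assumes K: "\<And>x y. pmf (K x) y = transition p h v q x y"
  shows "\<P>(\<omega> in M. \<forall>m\<le>N. S m \<omega> = w m)
    = of_bool (w 0 = x) * (\<Prod>i<N. pmf (K (w i)) (w (Suc i)))"
proof (induction N)
  case 0
  have "\<P>(\<omega> in M. S 0 \<omega> = w 0) = \<P>(\<omega> in M. x = w 0)"
    using S_start S_measurable by (intro prob_eq_AE) auto
  thus ?case by (simp add: prob_space)
next
  case (Suc N)
  let ?A = "{\<omega> \<in> space M. \<forall>m\<le>N. S m \<omega> = w m}"
  let ?B = "{\<omega> \<in> space M. \<forall>m\<le>Suc N. S m \<omega> = w m}"
  have "prob ?B = prob ?A * pmf (K (w N)) (w (Suc N))"
  proof (cases "prob ?A > 0")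
    case True
    have "?B = {\<omega> \<in> space M. S (Suc N) \<omega> = w (Suc N) \<and> (\<forall>m\<le>N. S m \<omega> = w m)}"
      by (auto simp: le_Suc_eq)
    thus ?thesis
      using S_markov[OF True, of "w (Suc N)"] True by (simp add: cond_prob_def K field_simps)
  next
    \<comment> \<open>The Markov property says nothing after a null history; there both sides are
      0.\<close>
    case False
    hence "prob ?A = 0" using measure_nonneg[of M ?A] by linarith
    moreover have "prob ?B \<le> prob ?A" 
      by (rule finite_measure_mono[OF _ measurable_S_set]) (blast intro: le_SucI)
    ultimately show ?thesis using measure_nonneg[of M ?B] by simp
  qed
  thus ?case using Suc.IH by (simp add: mult.assoc)
qed

lemma history_eq_iff:
  "map (\<lambda>m. S m \<omega>) [0..<Suc N] = l \<longleftrightarrow> length l = Suc N \<and> (\<forall>m\<le>N. S m \<omega> = l ! m)"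
proof -
  have "map (\<lambda>m. S m \<omega>) [0..<Suc N] = l \<longleftrightarrow> length l = Suc N \<and> (\<forall>m<Suc N. S m \<omega> = l ! m)"
    unfolding list_eq_iff_nth_eq by (simp del: upt_Suc cong: conj_cong) metis
  thus ?thesis by (simp only: less_Suc_eq_le)
qed

lemma history_measurable [measurable]:
  "(\<lambda>\<omega>. map (\<lambda>m. S m \<omega>) [0..<Suc N]) \<in> measurable M (count_space UNIV)"
  unfolding measurable_count_space_eq_countable[OF countableI_type]
proof (intro conjI ballI)
  fix l :: "(nat \<times> nat) list"
  have vimage: "(\<lambda>\<omega>. map (\<lambda>m. S m \<omega>) [0..<Suc N]) -` {l} \<inter> space M
      = (if length l = Suc N then {\<omega> \<in> space M. \<forall>m\<le>N. S m \<omega> = l ! m} else {})"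
    unfolding vimage_def Int_def mem_Collect_eq singleton_iff history_eq_iff by auto
  show "(\<lambda>\<omega>. map (\<lambda>m. S m \<omega>) [0..<Suc N]) -` {l} \<inter> space M \<in> events"
    unfolding vimage by (simp only: measurable_S_set sets.empty_sets simp_thms split: if_split)
qed simp

text \<open>The lists of states form a countable type, so agreement on singletons suffices. Lists of
  length other than \<open>Suc N\<close> have mass 0 under both laws.\<close>

lemma distr_history:
  assumes K: "\<And>x y. pmf (K x) y = transition p h v q x y"
  shows "distr M (count_space UNIV) (\<lambda>\<omega>. map (\<lambda>m. S m \<omega>) [0..<Suc N]) = measure_pmf (paths K N x)"
    (is "?D = _")
proof (rule measure_eqI_countable)
  interpret D: prob_space ?D
    by (rule prob_space_distr[OF history_measurable])
  fix l :: "(nat \<times> nat) list"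
  have "measure ?D {l} = \<P>(\<omega> in M. length l = Suc N \<and> (\<forall>m\<le>N. S m \<omega> = l ! m))"
    by (subst measure_distr[OF history_measurable])
      (simp_all only: vimage_def Int_def mem_Collect_eq singleton_iff history_eq_iff conj_commute sets_count_space Pow_UNIV UNIV_I)
  also have "\<dots> = pmf (paths K N x) l"
  proof (cases "length l = Suc N")
    case True
    hence "l = map (\<lambda>m. l ! m) [0..<Suc N]" by (metis map_nth)
    thus ?thesis
      using True prob_history[OF K, of N "\<lambda>m. l ! m"] pmf_paths[of K N x "\<lambda>m. l ! m"] by simp
  next
    case False
    thus ?thesis using length_paths[of l K N x] by (auto simp: set_pmf_iff)
  qed
  finally show "emeasure ?D {l} = emeasure (measure_pmf (paths K N x)) {l}"
    by (simp add: D.emeasure_eq_measure emeasure_pmf_single del: upt_Suc)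
next
  show "sets ?D = Pow UNIV" "sets (measure_pmf (paths K N x)) = Pow UNIV"
    by (simp_all del: upt_Suc)
qed (rule countableI_type)

lemma visits_measurable [measurable]: "visits S N \<in> measurable M (count_space UNIV)"
  unfolding visits_def[abs_def] by (rule measurable_compose[OF history_measurable]) simp

lemma prob_visits:
  assumes K: "\<And>x y. pmf (K x) y = transition p h v q x y"
  shows "\<P>(\<omega> in M. m \<le> visits S N \<omega>) = visit_tail K boundary N m x"
  unfolding visit_tail_def distr_history[OF K, symmetric]
  by (subst measure_distr[OF history_measurable])
    (simp_all add: visits_def vimage_def Int_def conj_commute del: upt_Suc)

text \<open>Having \<open>m\<close> contacts by time \<open>N\<close> is increasing in
  \<open>N\<close>, so continuity from below turns the finite-horizon tails into
  \<open>visit_prob\<close>; exactly \<open>n\<close> contacts is a difference of two nested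
  events.\<close>

lemma prob_contacts:
  assumes K: "\<And>x y. pmf (K x) y = transition p h v q x y"
  shows "\<P>(\<omega> in M. contacts S \<omega> = of_nat n) = visit_prob K boundary n x - visit_prob K boundary (Suc n) x"
proof -
  have visits_mono: "visits S N \<omega> \<le> visits S (Suc N) \<omega>" for N \<omega>
    by (simp add: visits_Suc)
  have ex: "\<P>(\<omega> in M. \<exists>N. m \<le> visits S N \<omega>) = visit_prob K boundary m x" for m
  proof (rule LIMSEQ_unique)
    have "incseq (\<lambda>N. {\<omega> \<in> space M. m \<le> visits S N \<omega>})"
      by (rule incseq_SucI) (use visits_mono order_trans in blast)
    hence "(\<lambda>N. \<P>(\<omega> in M. m \<le> visits S N \<omega>)) \<longlonglongrightarrow> prob (\<Union>N. {\<omega> \<in> space M. m \<le> visits S N \<omega>})"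
      by (intro finite_Lim_measure_incseq) auto
    moreover have "(\<Union>N. {\<omega> \<in> space M. m \<le> visits S N \<omega>}) = {\<omega> \<in> space M. \<exists>N. m \<le> visits S N \<omega>}"
      by auto
    ultimately show "(\<lambda>N. \<P>(\<omega> in M. m \<le> visits S N \<omega>)) \<longlonglongrightarrow> \<P>(\<omega> in M. \<exists>N. m \<le> visits S N \<omega>)"
      by simp
    show "(\<lambda>N. \<P>(\<omega> in M. m \<le> visits S N \<omega>)) \<longlonglongrightarrow> visit_prob K boundary m x"
      unfolding prob_visits[OF K] by (rule visit_tail_tendsto)
  qed
  have "{\<omega> \<in> space M. contacts S \<omega> = of_nat n}
      = {\<omega> \<in> space M. \<exists>N. n \<le> visits S N \<omega>} - {\<omega> \<in> space M. \<exists>N. Suc n \<le> visits S N \<omega>}"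
    unfolding contacts_eq_iff by blast
  also have "prob \<dots> = \<P>(\<omega> in M. \<exists>N. n \<le> visits S N \<omega>) - \<P>(\<omega> in M. \<exists>N. Suc n \<le> visits S N \<omega>)"
    by (rule finite_measure_Diff) (auto dest: Suc_leD)
  finally show ?thesis unfolding ex .
qed

end

subsection \<open>The exponential rates of the boundary contacts\<close>

text \<open>Adding 1 to the jump gives a law \<open>\<kappa>\<close> on the naturals with mean above
  1 and an atom at 0, so \<open>subcritical_fixed_point\<close> applies. Dividing the fixed-point
  equation by \<open>a\<close> gives the harmonicity condition.\<close>

lemma drift_root:
  fixes P :: "'a pmf" and g :: "'a \<Rightarrow> int"
  assumes ge: "\<And>x. x \<in> set_pmf P \<Longrightarrow> - 1 \<le> g x"
    and down: "x0 \<in> set_pmf P" "g x0 = - 1"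
    and drift: "0 < (\<Sum>\<^sub>\<infinity>x. pmf P x * real_of_int (g x))"
  shows "\<exists>!a::real. 0 < a \<and> a < 1 \<and> a = (\<Sum>\<^sub>\<infinity>x. pmf P x * a powi (g x + 1))"
    and "0 < a \<Longrightarrow> a < 1 \<Longrightarrow> a = (\<Sum>\<^sub>\<infinity>x. pmf P x * a powi (g x + 1))
      \<Longrightarrow> measure_pmf.expectation P (\<lambda>x. a powi g x) = 1"
proof -
  define \<kappa> where "\<kappa> = map_pmf (\<lambda>x. nat (g x + 1)) P"
  have pow: "(\<Sum>\<^sub>\<infinity>x. pmf P x * a powi (g x + 1)) = measure_pmf.expectation P (\<lambda>x. a powi (g x + 1))"
    "measure_pmf.expectation P (\<lambda>x. a powi (g x + 1)) = measure_pmf.expectation \<kappa> (\<lambda>n. a ^ n)"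
    if "0 < a" "a < 1" for a :: real
  proof -
    have "integrable (measure_pmf P) (\<lambda>x. a powi (g x + 1))"
      using that ge power_int_decreasing[of 0 _ a]
      by (intro measure_pmf_integrable_bounded[where C = 1]) fastforce
    thus "(\<Sum>\<^sub>\<infinity>x. pmf P x * a powi (g x + 1)) = measure_pmf.expectation P (\<lambda>x. a powi (g x + 1))"
      by (simp add: expectation_pmf_eq_infsum)
    show "measure_pmf.expectation P (\<lambda>x. a powi (g x + 1)) = measure_pmf.expectation \<kappa> (\<lambda>n. a ^ n)"
      unfolding \<kappa>_def integral_map_pmf
      using ge by (intro expectation_pmf_cong) (force simp: power_int_def)
  qed
  \<comment> \<open>A sum that does not converge has value 0, so the strict inequality
    \<open>drift\<close> includes summability.\<close>
  have int_g: "integrable (measure_pmf P) (\<lambda>x. real_of_int (g x))"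
    unfolding integrable_measure_pmf_iff_summable
    using drift by (metis infsum_not_exists less_irrefl)
  have shift: "real (nat (g x + 1)) = real_of_int (g x) + 1" if "x \<in> set_pmf P" for x
    using ge[OF that] by simp
  have "integrable (measure_pmf P) (\<lambda>x. real (nat (g x + 1)))
      \<longleftrightarrow> integrable (measure_pmf P) (\<lambda>x. real_of_int (g x) + 1)"
    using shift by (intro integrable_cong_AE) (auto simp: AE_measure_pmf_iff)
  hence "integrable (measure_pmf \<kappa>) real"
    using int_g by (simp add: \<kappa>_def)
  moreover have "measure_pmf.expectation \<kappa> real = measure_pmf.expectation P (\<lambda>x. real_of_int (g x)) + 1"
    unfolding \<kappa>_def integral_map_pmf using int_g
    by (subst expectation_pmf_cong[OF shift]) auto
  hence "1 < measure_pmf.expectation \<kappa> real"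
    using drift expectation_pmf_eq_infsum[OF int_g] by simp
  moreover have "0 \<in> set_pmf \<kappa>" using down by (force simp: \<kappa>_def)
  ultimately have "\<exists>!a::real. 0 < a \<and> a < 1 \<and> a = measure_pmf.expectation \<kappa> (\<lambda>n. a ^ n)"
    by (rule subcritical_fixed_point)
  moreover have "0 < a \<and> a < 1 \<and> a = measure_pmf.expectation \<kappa> (\<lambda>n. a ^ n)
      \<longleftrightarrow> 0 < a \<and> a < 1 \<and> a = (\<Sum>\<^sub>\<infinity>x. pmf P x * a powi (g x + 1))" for a :: real
    by (intro conj_cong refl) (simp only: pow)
  ultimately show "\<exists>!a::real. 0 < a \<and> a < 1 \<and> a = (\<Sum>\<^sub>\<infinity>x. pmf P x * a powi (g x + 1))"
    by (simp only:)
  assume a: "0 < a" "a < 1" "a = (\<Sum>\<^sub>\<infinity>x. pmf P x * a powi (g x + 1))"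
  hence "a = measure_pmf.expectation P (\<lambda>x. a powi (g x + 1))" using pow(1) by simp
  also have "\<dots> = measure_pmf.expectation P (\<lambda>x. a powi g x) * a"
    using a by (simp add: power_int_add)
  finally show "measure_pmf.expectation P (\<lambda>x. a powi g x) = 1" using a(1) by simp
qed

text \<open>Almost surely no jump leaves the quadrant, so up to a null set only the jump
  \<open>(i' - i, j' - j)\<close> leads from \<open>(i, j)\<close> to \<open>(i', j')\<close>, and
  clipping by \<open>nat\<close> adds no mass.\<close>

lemma pmf_quadrant_step:
  assumes P: "\<And>k l. pmf P (k, l) = p k l" and H: "\<And>k l. pmf H (k, l) = h k l"
    and V: "\<And>k l. pmf V (k, l) = v k l" and Q: "\<And>k l. pmf Q (k, l) = q k l"
    and P_ge: "\<And>k l. (k, l) \<in> set_pmf P \<Longrightarrow> - 1 \<le> k \<and> - 1 \<le> l"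
    and boundary_ge: "\<And>k l. (k, l) \<in> set_pmf H \<union> set_pmf V \<union> set_pmf Q \<Longrightarrow> 0 \<le> k \<and> 0 \<le> l"
  shows "pmf (quadrant_step P H V Q x) y = transition p h v q x y"
proof -
  obtain i j i' j' where xy: "x = (i, j)" "y = (i', j')" by (metis surj_pair)
  let ?J = "jump_pmf P H V Q (i, j)"
  have J_ge: "0 \<le> int i + k \<and> 0 \<le> int j + l" if "(k, l) \<in> set_pmf ?J" for k l
    using that P_ge[of k l] boundary_ge[of k l] by (auto simp: jump_pmf_def split: if_splits)
  have "pmf (quadrant_step P H V Q x) y
      = measure ?J ((\<lambda>(k, l). (nat (int i + k), nat (int j + l))) -` {(i', j')})"
    by (simp add: xy quadrant_step_def pmf_map)
  also have "\<dots> = measure ?J {(int i' - int i, int j' - int j)}"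
    by (intro measure_pmf.finite_measure_eq_AE) (auto simp: AE_measure_pmf_iff dest!: J_ge)
  also have "\<dots> = transition p h v q x y"
    by (simp add: measure_pmf_single xy transition_def jump_pmf_def jump_weights_def P H V Q)
  finally show ?thesis .
qed

theorem lemma15:
  fixes p h v q :: "int \<Rightarrow> int \<Rightarrow> real"
    and M :: "nat \<times> nat \<Rightarrow> 'a measure"
    and S :: "nat \<times> nat \<Rightarrow> nat \<Rightarrow> 'a \<Rightarrow> nat \<times> nat"
    and f :: "nat \<Rightarrow> nat \<Rightarrow> nat \<Rightarrow> real"
    and n :: nat
  assumes "singular_reflected_data p h v q"
    and "\<And>x. reflected_walk (M x) p h v q x (S x)"
    and f_def: "\<And>n i j. f n i j = \<P>(\<omega> in M (i, j). contacts (S (i, j)) \<omega> = of_nat n)"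
    and "n \<ge> 1"
  shows "(\<lambda>(i, j). f n i j -
            ((1 - v_tilde1 p v) * v_tilde1 p v ^ (n - 1) * alpha1 p ^ i +
             (1 - h_tilde0 p h) * h_tilde0 p h ^ (n - 1) * beta_m1 p ^ j))
         \<in> o[filtercomap (\<lambda>(i, j). i + j) at_top](\<lambda>_. 1)"
proof -
  interpret data: singular_reflected_data p h v q by fact
  obtain P where P: "\<And>k l. pmf P (k, l) = p k l" using weights_pmf[OF data.weights(1)] by blast
  obtain H where H: "\<And>k l. pmf H (k, l) = h k l" using weights_pmf[OF data.weights(2)] by blast
  obtain V where V: "\<And>k l. pmf V (k, l) = v k l" using weights_pmf[OF data.weights(3)] by blast
  obtain Q where Q: "\<And>k l. pmf Q (k, l) = q k l" using weights_pmf[OF data.weights(4)] by blast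
  have P_ge: "- 1 \<le> k \<and> - 1 \<le> l" if "(k, l) \<in> set_pmf P" for k l
    using that data.p_small_neg_jumps[of k l] by (force simp: set_pmf_iff P)
  have boundary_ge: "0 \<le> k \<and> 0 \<le> l" if "(k, l) \<in> set_pmf H \<union> set_pmf V \<union> set_pmf Q" for k l
    using that data.boundary_jumps[of k l] by (force simp: set_pmf_iff H V Q)
  \<comment> \<open>The antidiagonal jumps lower each coordinate by 1 with positive probability, as
    needed for the roots and for the maximum principle.\<close>
  have left: "(- 1, 1) \<in> set_pmf P" and down: "(1, - 1) \<in> set_pmf P"
    using data.p_antidiagonal by (auto simp: set_pmf_iff P)
  have drift: "0 < (\<Sum>\<^sub>\<infinity>x. pmf P x * real_of_int (fst x))" "0 < (\<Sum>\<^sub>\<infinity>x. pmf P x * real_of_int (snd x))"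
    using data.interior_drift
    by (simp_all add: mean1_def mean2_def P[symmetric] case_prod_unfold mult.commute)
  let ?a = "alpha1 p" and ?b = "beta_m1 p"
  have a: "0 < ?a \<and> ?a < 1 \<and> ?a = (\<Sum>\<^sub>\<infinity>x. pmf P x * ?a powi (fst x + 1))"
    unfolding alpha1_def P[symmetric] case_prod_unfold prod.collapse
    by (rule theI') (rule drift_root(1)[OF _ left _ drift(1)]; use P_ge in force)
  have b: "0 < ?b \<and> ?b < 1 \<and> ?b = (\<Sum>\<^sub>\<infinity>x. pmf P x * ?b powi (snd x + 1))"
    unfolding beta_m1_def P[symmetric] case_prod_unfold prod.collapse
    by (rule theI') (rule drift_root(1)[OF _ down _ drift(2)]; use P_ge in force)
  interpret quadrant_kernel P H V Q ?a ?b
  proof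
    show "measure_pmf.expectation P (\<lambda>(k, l). ?a powi k) = 1"
      unfolding case_prod_unfold
      by (rule drift_root(2)[OF _ left _ drift(1)]) (use P_ge a in force)+
    show "measure_pmf.expectation P (\<lambda>(k, l). ?b powi l) = 1"
      unfolding case_prod_unfold
      by (rule drift_root(2)[OF _ down _ drift(2)]) (use P_ge b in force)+
  qed (use P_ge boundary_ge a b left down in blast)+
  have K: "pmf (K x) y = transition p h v q x y" for x y
    using P H V Q P_ge boundary_ge by (rule pmf_quadrant_step)
  have "integrable (measure_pmf V) (\<lambda>(k, l). ?a powi k)"
    by (rule measure_pmf_integrable_bounded[where C = 1]) (use a powi_le_1 boundary_ge in force)
  hence vt: "vt = v_tilde1 p v"
    by (simp add: vt_def v_tilde1_def expectation_pmf_eq_infsum case_prod_unfold V[symmetric])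
  have ht: "ht = h_tilde0 p h"
    using H_integrable(2)
    by (simp add: ht_def h_tilde0_def expectation_pmf_eq_infsum case_prod_unfold H[symmetric])
  have f: "f n i j = T n (i, j) - T (Suc n) (i, j)" for i j
    unfolding f_def by (rule reflected_walk.prob_contacts[OF assms(2) K])
  let ?err = "\<lambda>(i, j). f n i j - ((1 - v_tilde1 p v) * v_tilde1 p v ^ (n - 1) * ?a ^ i +
    (1 - h_tilde0 p h) * h_tilde0 p h ^ (n - 1) * ?b ^ j)"
  let ?F = "filtercomap (\<lambda>(i, j). i + j) at_top :: (nat \<times> nat) filter"
  have "(?err \<longlongrightarrow> 0) ?F"
  proof (rule Lim_null_comparison)
    \<comment> \<open>The bound depends on the site only through \<open>i + j\<close>, so its limit
      is computed along the naturals and pulled back through \<open>filtercomap\<close>.\<close>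
    show "\<forall>\<^sub>F x in ?F. norm (?err x) \<le> 3 * max ?a ?b ^ ((case x of (i, j) \<Rightarrow> i + j) div 2)"
      using visit_prob_diff[OF \<open>n \<ge> 1\<close>] by (auto simp: f vt ht intro!: always_eventually)
    have "(\<lambda>r. max ?a ?b ^ r) \<longlonglongrightarrow> 0"
      using a b by (intro LIMSEQ_realpow_zero) auto
    moreover have "filterlim (\<lambda>s::nat. s div 2) at_top at_top"
      unfolding filterlim_at_top
    proof
      fix z :: nat
      show "\<forall>\<^sub>F s in at_top. z \<le> s div 2"
        using eventually_ge_at_top[of "2 * z"] by eventually_elim simp
    qed
    ultimately have "(\<lambda>s. 3 * max ?a ?b ^ (s div 2)) \<longlonglongrightarrow> 0"
      by (intro tendsto_mult_right_zero) (rule filterlim_compose)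
    thus "((\<lambda>x. 3 * max ?a ?b ^ ((case x of (i, j) \<Rightarrow> i + j) div 2)) \<longlongrightarrow> 0) ?F"
      by (rule filterlim_filtercomapI)
  qed
  thus ?thesis by (intro smalloI_tendsto) (auto simp: case_prod_unfold)
qed

end
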